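(* Let $G$ be a graph of order $n$ with vertex set $V(G)=\{v_1,\dots,v_n\}$ and minimum degree $\delta$, and let $\mathbf{r}=(r_1,\dots,r_n)$ and $\mathbf{s}=(s_1,\dots,s_n)$ be $n$-tuples of nonnegative integers. Put $$\tau=\min\{r_1,\dots,r_n\},\quad s=\max\{s_1,\dots,s_n\},\quad r=\left\lfloor \frac{s}{\delta+1}\right\rfloor+1,\quad \theta=(\delta+1)r-s,\quad B_{s-1}=\binom{(\delta+1)r}{s-1},\quad \rho=\frac1\theta .$$ If $r\le\tau$, then $$\gamma\langle \mathbf{r},\mathbf{s}\rangle(G)\le\left(1-\frac{(r\rho)^{\rho}}{(1+\rho)^{1+\rho}\,B_{s-1}^{\rho}}\right) r n .$$
   Context: All graphs are finite, undirected, without loops and multiple edges. $N[v]$ denotes the closed neighbourhood of $v$ (the neighbours of $v$ together with $v$). Let $\mathbf{N}$ denote the set of nonnegative integers. A function $f:V(G)\to\mathbf{N}$ is an $\mathbf{r}$-function of $G$ if $f(v_i)\le r_i$ for all $i=1,\dots,n$. An $\mathbf{r}$-function $f$ is $\mathbf{s}$-dominating if $\sum_{u\in N[v_i]}f(u)\ge s_i$ for all $i=1,\dots,n$. The weight of $f$ is $|f|=\sum_{i=1}^n f(v_i)$. The $\langle\mathbf{r},\mathbf{s}\rangle$-domination number $\gamma\langle\mathbf{r},\mathbf{s}\rangle(G)$ is the smallest weight of an $\mathbf{s}$-dominating $\mathbf{r}$-function of $G$ (such functions exist if and only if $\sum_{v_j\in N[v_i]}r_j\ge s_i$ for all $i=1,\dots,n$).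 *)

theory Defs
  imports Complex_Main "Graph_Theory.Graph_Theory"
begin

(* A finite simple undirected graph is a pair_graph: an edge uv is the pair of arcs
   (u,v) and (v,u), so the degree of a vertex is its out_degree. The n-tuples indexed
   by v_1, ..., v_n are functions on vertices; only their values on pverts G matter. *)

definition closed_nbhd :: "'a pair_pre_digraph \<Rightarrow> 'a \<Rightarrow> 'a set" where
  "closed_nbhd G v = insert v {u. (v, u) \<in> parcs G}"

definition min_degree :: "'a pair_pre_digraph \<Rightarrow> nat" where
  "min_degree G = Min (out_degree (with_proj G) ` pverts G)"

definition bounded_fun :: "'a pair_pre_digraph \<Rightarrow> ('a \<Rightarrow> nat) \<Rightarrow> ('a \<Rightarrow> nat) \<Rightarrow> bool" where
  "bounded_fun G r f \<longleftrightarrow> (\<forall>v\<in>pverts G. f v \<le> r v)"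

definition dominating :: "'a pair_pre_digraph \<Rightarrow> ('a \<Rightarrow> nat) \<Rightarrow> ('a \<Rightarrow> nat) \<Rightarrow> bool" where
  "dominating G s f \<longleftrightarrow> (\<forall>v\<in>pverts G. (\<Sum>u\<in>closed_nbhd G v. f u) \<ge> s v)"

definition weight :: "'a pair_pre_digraph \<Rightarrow> ('a \<Rightarrow> nat) \<Rightarrow> nat" where
  "weight G f = (\<Sum>v\<in>pverts G. f v)"

(* The infimum of the empty set of naturals is 0, so domination_number is meaningful
   only under the condition of ex_dominating_iff below; then the infimum is attained. *)
definition domination_number :: "'a pair_pre_digraph \<Rightarrow> ('a \<Rightarrow> nat) \<Rightarrow> ('a \<Rightarrow> nat) \<Rightarrow> nat" where
  "domination_number G r s = Inf {weight G f | f. bounded_fun G r f \<and> dominating G s f}"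

lemma (in pair_graph) ex_dominating_iff:
  "(\<exists>f. bounded_fun G r f \<and> dominating G s f) \<longleftrightarrow>
   (\<forall>v\<in>pverts G. (\<Sum>u\<in>closed_nbhd G v. r u) \<ge> s v)"
proof
  assume "\<exists>f. bounded_fun G r f \<and> dominating G s f"
  then obtain f where f: "bounded_fun G r f" "dominating G s f" by blast
  show "\<forall>v\<in>pverts G. (\<Sum>u\<in>closed_nbhd G v. r u) \<ge> s v"
  proof
    fix v assume v: "v \<in> pverts G"
    have "(\<Sum>u\<in>closed_nbhd G v. f u) \<le> (\<Sum>u\<in>closed_nbhd G v. r u)"
      using f(1) v by (intro sum_mono) (auto simp: bounded_fun_def closed_nbhd_def dest: in_arcsD2)
    with f(2) v show "(\<Sum>u\<in>closed_nbhd G v. r u) \<ge> s v"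
      by (auto simp: dominating_def intro: order_trans)
  qed
next
  assume "\<forall>v\<in>pverts G. (\<Sum>u\<in>closed_nbhd G v. r u) \<ge> s v"
  then show "\<exists>f. bounded_fun G r f \<and> dominating G s f"
    by (auto simp: bounded_fun_def dominating_def intro!: exI[of _ r])
qed

lemma domination_number_attained:
  assumes "bounded_fun G r f" "dominating G s f"
  obtains g where "bounded_fun G r g" "dominating G s g" "weight G g = domination_number G r s"
proof -
  let ?W = "{weight G f | f. bounded_fun G r f \<and> dominating G s f}"
  have "?W \<noteq> {}" using assms by blast
  then have "Inf ?W \<in> ?W" by (rule Inf_nat_def1)
  then show thesis using that unfolding domination_number_def by auto
qed

end

theory Submission
  imports Defs
begin

text \<open>
  The bound comes from a random dominating function. Give every vertex \<open>r\<close> tokens, so that the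
  constant function \<open>r\<close> counts the tokens at each vertex, and delete each token independently with
  probability \<open>q\<close>. The surviving tokens form a function of expected weight \<open>(1 - q) r n\<close> that may
  fail to dominate at some vertices.

  At each vertex \<open>v\<close> fix \<open>\<delta> + 1\<close> vertices of its closed neighbourhood. They carry
  \<open>(\<delta> + 1) r = s + t\<close> tokens, with \<open>t \<ge> 1\<close> by the choice of \<open>r\<close>. If \<open>k\<close> of these are deleted, then
  \<open>v\<close> is short by at most \<open>k - t\<close> (truncated), and since a cap of \<open>r \<le> \<tau>\<close> per vertex leaves room for
  at least \<open>s\<close> tokens there, the shortage can be repaired by restoring as many tokens (\<open>repair_sums\<close>).
  The key estimate is \<open>k - t \<le> k choose (t + 1)\<close>: the binomial coefficient counts the sets of
  \<open>t + 1\<close> tokens around \<open>v\<close> that have been deleted completely, and each such set is deleted with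
  probability \<open>q ^ (t + 1)\<close>. So repairing costs at most \<open>(s + t choose t + 1) * q ^ (t + 1)\<close> per
  vertex on average, and this binomial coefficient is \<open>B\<close> by symmetry (when \<open>s > 0\<close>). Thus
  \<open>\<gamma> \<le> (1 - q) r n + n B q ^ (t + 1)\<close> for all \<open>q\<close> between \<open>0\<close> and \<open>1\<close>.
  The right-hand side is least where \<open>q ^ t = r / (B (1 + t))\<close>, and its value there is the
  bound, written with \<open>\<rho> = 1 / t\<close>.
\<close>

section \<open>Repairing a function that misses prescribed sums\<close>

lemma raise_sum:
  fixes f c :: "'a \<Rightarrow> nat"
  assumes "finite V" "A \<subseteq> V" "\<forall>v\<in>V. f v \<le> c v" "s \<le> sum c A"
  obtains g where "\<forall>v\<in>V. f v \<le> g v \<and> g v \<le> c v" "s \<le> sum g A"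
    "sum g V \<le> sum f V + (s - sum f A)"
proof -
  have "\<exists>g. (\<forall>v\<in>V. f v \<le> g v \<and> g v \<le> c v) \<and> s \<le> sum g A \<and> sum g V \<le> sum f V + d"
    if "s - sum f A = d" "\<forall>v\<in>V. f v \<le> c v" for d
    using that
  proof (induction d arbitrary: f)
    case 0
    then show ?case by (intro exI[of _ f]) auto
  next
    case (Suc d)
    have "sum f A < sum c A" using Suc.prems(1) assms(4) by linarith
    then obtain v where v: "v \<in> A" "f v < c v"
      by (meson sum_mono not_less)
    let ?f = "f(v := Suc (f v))"
    have fin: "finite A" using assms finite_subset by blast
    have up: "sum ?f X = Suc (sum f X)" if "finite X" "v \<in> X" for X
      using that by (simp add: sum.remove[of X v])
    have "v \<in> V" using v assms by blast
    have "s - sum ?f A = d" using Suc.prems(1) up[OF fin v(1)] by linarith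
    moreover have "\<forall>u\<in>V. ?f u \<le> c u" using Suc.prems(2) v(2) by auto
    ultimately obtain g where g: "\<forall>u\<in>V. ?f u \<le> g u \<and> g u \<le> c u" "s \<le> sum g A"
        "sum g V \<le> sum ?f V + d"
      using Suc.IH by blast
    have "\<forall>u\<in>V. f u \<le> g u \<and> g u \<le> c u"
      using g(1) by (metis Suc_leD fun_upd_apply)
    then show ?case
      using g up[OF assms(1) \<open>v \<in> V\<close>] by (intro exI[of _ g]) auto
  qed
  from this[OF refl assms(3)] show thesis using that by blast
qed

text \<open>Raising the function for one set never hurts the others, so the shortages may be repaired one
  set at a time, each at a cost not exceeding its shortage in the original function.\<close>

lemma repair_sums:
  fixes f c :: "'a \<Rightarrow> nat"
  assumes "finite V" "finite S" "\<And>x. x \<in> S \<Longrightarrow> N x \<subseteq> V" "\<forall>v\<in>V. f v \<le> c v"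
    and "\<And>x. x \<in> S \<Longrightarrow> s \<le> sum c (N x)"
  obtains g where "\<forall>v\<in>V. f v \<le> g v \<and> g v \<le> c v" "\<forall>x\<in>S. s \<le> sum g (N x)"
    "sum g V \<le> sum f V + (\<Sum>x\<in>S. s - sum f (N x))"
proof -
  have "\<exists>g. (\<forall>v\<in>V. f v \<le> g v \<and> g v \<le> c v) \<and> (\<forall>x\<in>S. s \<le> sum g (N x)) \<and>
      sum g V \<le> sum f V + (\<Sum>x\<in>S. s - sum f (N x))"
    using assms(2,3,5)
  proof (induction S)
    case empty
    then show ?case using assms(4) by (intro exI[of _ f]) auto
  next
    case (insert x S)
    then obtain g where g: "\<forall>v\<in>V. f v \<le> g v \<and> g v \<le> c v" "\<forall>x\<in>S. s \<le> sum g (N x)"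
      "sum g V \<le> sum f V + (\<Sum>x\<in>S. s - sum f (N x))" by blast
    obtain h where h: "\<forall>v\<in>V. g v \<le> h v \<and> h v \<le> c v" "s \<le> sum h (N x)"
      "sum h V \<le> sum g V + (s - sum g (N x))"
      using raise_sum[of V "N x" g c s] assms(1) insert.prems g(1) by blast
    have "sum f (N x) \<le> sum g (N x)"
      using g(1) insert.prems(1) by (intro sum_mono) blast
    moreover have "s \<le> sum h (N y)" if "y \<in> S" for y
    proof -
      have "sum g (N y) \<le> sum h (N y)"
        using h(1) insert.prems(1) that by (intro sum_mono) blast
      then show ?thesis using g(2) that by fastforce
    qed
    moreover have "\<forall>v\<in>V. f v \<le> h v \<and> h v \<le> c v"
      using g(1) h(1) by (meson order_trans)
    ultimately show ?case
      using h g(3) insert.hyps by (intro exI[of _ h]) auto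
  qed
  then show thesis using that by blast
qed

section \<open>Averages over random subsets\<close>

text \<open>The probability of \<open>W\<close> as the random subset of \<open>U\<close> that contains each element of \<open>U\<close>
  independently with probability \<open>q\<close>.\<close>

definition random_subset_prob :: "real \<Rightarrow> 'b set \<Rightarrow> 'b set \<Rightarrow> real" where
  "random_subset_prob q U W = q ^ card W * (1 - q) ^ card (U - W)"

text \<open>Expand the product over \<open>U\<close> of \<open>q + b x\<close>, where \<open>b x\<close> is \<open>0\<close> on \<open>T\<close> and \<open>1 - q\<close> off \<open>T\<close>:
  exactly the subsets containing \<open>T\<close> contribute.\<close>

lemma prob_random_subset_superset:
  assumes "finite U" "T \<subseteq> U"
  shows "(\<Sum>W\<in>Pow U. random_subset_prob q U W * of_bool (T \<subseteq> W)) = q ^ card T"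
proof -
  let ?b = "\<lambda>x. if x \<in> T then 0 else 1 - q"
  have "(\<Prod>x\<in>U. q + ?b x) = (\<Prod>x\<in>U. if x \<in> T then q else 1)"
    by (intro prod.cong) auto
  also have "\<dots> = q ^ card T"
    using assms by (simp add: prod.If_cases Int_absorb1)
  finally have "q ^ card T = (\<Sum>W\<in>Pow U. (\<Prod>x\<in>W. q) * (\<Prod>x\<in>U - W. ?b x))"
    using assms(1) by (subst (asm) prod_add) auto
  also have "\<dots> = (\<Sum>W\<in>Pow U. random_subset_prob q U W * of_bool (T \<subseteq> W))"
  proof (intro sum.cong refl)
    fix W assume W: "W \<in> Pow U"
    have "(\<Prod>x\<in>U - W. ?b x) = (1 - q) ^ card (U - W) * of_bool (T \<subseteq> W)"
    proof (cases "T \<subseteq> W")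
      case True
      then have "(\<Prod>x\<in>U - W. ?b x) = (\<Prod>x\<in>U - W. 1 - q)"
        by (intro prod.cong) auto
      then show ?thesis using True by simp
    next
      case False
      then obtain x where "x \<in> T" "x \<notin> W" by blast
      then have "(\<Prod>x\<in>U - W. ?b x) = 0"
        using assms by (intro prod_zero) auto
      then show ?thesis using False by simp
    qed
    then show "(\<Prod>x\<in>W. q) * (\<Prod>x\<in>U - W. ?b x) = random_subset_prob q U W * of_bool (T \<subseteq> W)"
      by (simp add: random_subset_prob_def)
  qed
  finally show ?thesis by simp
qed

lemma sum_random_subset_prob:
  assumes "finite U"
  shows "(\<Sum>W\<in>Pow U. random_subset_prob q U W) = 1"
  using prob_random_subset_superset[of U "{}" q] assms by simp

lemma random_subset_prob_nonneg: "0 \<le> q \<Longrightarrow> q \<le> 1 \<Longrightarrow> 0 \<le> random_subset_prob q U W"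
  by (simp add: random_subset_prob_def)

text \<open>The binomial coefficient counts the \<open>j\<close>-subsets of \<open>M\<close> inside the random set, and each
  \<open>j\<close>-subset lies in it with probability \<open>q ^ j\<close>.\<close>

lemma expectation_choose_random_subset:
  assumes "finite U" "M \<subseteq> U"
  shows "(\<Sum>W\<in>Pow U. random_subset_prob q U W * real (card (W \<inter> M) choose j))
    = real (card M choose j) * q ^ j"
proof -
  let ?J = "{T. T \<subseteq> M \<and> card T = j}"
  have finM: "finite M" using assms finite_subset by blast
  have finJ: "finite ?J" using finM by simp
  have "real (card (W \<inter> M) choose j) = (\<Sum>T\<in>?J. of_bool (T \<subseteq> W))" for W
  proof -
    have "card (W \<inter> M) choose j = card {T. T \<subseteq> W \<inter> M \<and> card T = j}"
      using n_subsets[of "W \<inter> M" j] finM by simp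
    also have "{T. T \<subseteq> W \<inter> M \<and> card T = j} = ?J \<inter> {T. T \<subseteq> W}" by blast
    finally show ?thesis using finJ by (simp add: sum.If_cases of_bool_def)
  qed
  then have "(\<Sum>W\<in>Pow U. random_subset_prob q U W * real (card (W \<inter> M) choose j))
    = (\<Sum>W\<in>Pow U. \<Sum>T\<in>?J. random_subset_prob q U W * of_bool (T \<subseteq> W))"
    by (simp add: sum_distrib_left)
  also have "\<dots> = (\<Sum>T\<in>?J. \<Sum>W\<in>Pow U. random_subset_prob q U W * of_bool (T \<subseteq> W))"
    by (rule sum.swap)
  also have "\<dots> = (\<Sum>T\<in>?J. q ^ j)"
    using prob_random_subset_superset[OF assms(1)] assms(2) by (intro sum.cong) auto
  also have "\<dots> = real (card M choose j) * q ^ j"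
    using finM by (simp add: n_subsets)
  finally show ?thesis .
qed

section \<open>The averaged bound on the domination number\<close>

lemma diff_le_choose_Suc: "k - t \<le> k choose Suc t" for k t :: nat
proof (induction k)
  case (Suc k)
  show ?case
  proof (cases "t \<le> k")
    case True
    then have "1 \<le> k choose t" by (simp add: Suc_le_eq)
    moreover have "Suc k choose Suc t = (k choose t) + (k choose Suc t)" by simp
    ultimately show ?thesis using Suc.IH True by linarith
  qed simp
qed simp

context pair_graph
begin

lemma card_closed_nbhd: "card (closed_nbhd G v) = out_degree (with_proj G) v + 1"
proof -
  have "out_arcs (with_proj G) v = Pair v ` {u. (v, u) \<in> parcs G}"
    by (auto simp: out_arcs_def)
  then have "out_degree (with_proj G) v = card {u. (v, u) \<in> parcs G}"
    by (simp add: out_degree_def card_image inj_on_def)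
  moreover have "finite {u. (v, u) \<in> parcs G}"
    by (rule finite_subset[OF _ pair_finite_verts]) (auto dest: in_arcsD2)
  moreover have "v \<notin> {u. (v, u) \<in> parcs G}" using no_loops' by blast
  ultimately show ?thesis by (simp add: closed_nbhd_def)
qed

lemma closed_nbhd_subset: "v \<in> pverts G \<Longrightarrow> closed_nbhd G v \<subseteq> pverts G"
  by (auto simp: closed_nbhd_def dest: in_arcsD2)

lemma domination_number_le_weight:
  "bounded_fun G r f \<Longrightarrow> dominating G s f \<Longrightarrow> domination_number G r s \<le> weight G f"
  unfolding domination_number_def by (intro cInf_lower) auto

text \<open>\<open>W\<close> is the set of deleted tokens, the \<open>r\<close> tokens of a vertex \<open>v\<close> being the pairs \<open>(v, i)\<close>
  with \<open>i < r\<close>. The left side adds \<open>card W\<close> because the surviving function has weight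
  \<open>r * card (pverts G) - card W\<close>; the sum over \<open>v\<close> pays for the repair.\<close>

lemma domination_number_add_deleted_le:
  assumes N: "\<And>v. v \<in> pverts G \<Longrightarrow> N v \<subseteq> closed_nbhd G v"
    and cardN: "\<And>v. v \<in> pverts G \<Longrightarrow> card (N v) * r = s + t"
    and caps: "\<And>v. v \<in> pverts G \<Longrightarrow> r \<le> rv v"
    and dems: "\<And>v. v \<in> pverts G \<Longrightarrow> sv v \<le> s"
    and W: "W \<subseteq> pverts G \<times> {..<r}"
  shows "domination_number G rv sv + card W
    \<le> r * card (pverts G) + (\<Sum>v\<in>pverts G. card (W \<inter> N v \<times> {..<r}) choose Suc t)"
proof -
  define D where "D v = {i. (v, i) \<in> W}" for v
  define f where "f v = r - card (D v)" for v
  have D: "D v \<subseteq> {..<r}" for v using W by (auto simp: D_def)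
  have cardD: "card (D v) \<le> r" and finD: "finite (D v)" for v
    using card_mono[OF _ D] finite_subset[OF D] by auto
  have N': "N v \<subseteq> pverts G" if "v \<in> pverts G" for v
    using that N closed_nbhd_subset by blast
  have f_sum: "sum f A + card (W \<inter> A \<times> {..<r}) = card A * r" if "A \<subseteq> pverts G" for A
  proof -
    have finA: "finite A" using that pair_finite_verts finite_subset by blast
    have "W \<inter> A \<times> {..<r} = Sigma A D" using W by (auto simp: D_def)
    then have "card (W \<inter> A \<times> {..<r}) = (\<Sum>v\<in>A. card (D v))"
      using finA finD by simp
    then have "sum f A + card (W \<inter> A \<times> {..<r}) = (\<Sum>v\<in>A. f v + card (D v))"
      by (simp add: sum.distrib)
    also have "\<dots> = card A * r" using cardD by (simp add: f_def)
    finally show ?thesis .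
  qed
  obtain g where g: "\<forall>v\<in>pverts G. f v \<le> g v \<and> g v \<le> r" "\<forall>v\<in>pverts G. s \<le> sum g (N v)"
    "sum g (pverts G) \<le> sum f (pverts G) + (\<Sum>v\<in>pverts G. s - sum f (N v))"
    by (rule repair_sums[of "pverts G" "pverts G" N f "\<lambda>_. r" s])
      (use N' cardN pair_finite_verts in \<open>auto simp: f_def\<close>)
  have "bounded_fun G rv g"
    using g(1) caps by (auto simp: bounded_fun_def intro: order_trans)
  moreover have "dominating G sv g"
    unfolding dominating_def
  proof
    fix v assume v: "v \<in> pverts G"
    have "sum g (N v) \<le> sum g (closed_nbhd G v)"
      using N[OF v] closed_nbhd_subset[OF v] pair_finite_verts
      by (intro sum_mono2) (auto intro: finite_subset)
    then show "sv v \<le> sum g (closed_nbhd G v)"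
      using g(2) dems v by (meson order_trans)
  qed
  ultimately have "domination_number G rv sv \<le> sum g (pverts G)"
    using domination_number_le_weight unfolding weight_def by blast
  also note g(3)
  also have "(\<Sum>v\<in>pverts G. s - sum f (N v))
      \<le> (\<Sum>v\<in>pverts G. card (W \<inter> N v \<times> {..<r}) choose Suc t)"
  proof (intro sum_mono)
    fix v assume v: "v \<in> pverts G"
    have "s - sum f (N v) \<le> card (W \<inter> N v \<times> {..<r}) - t"
      using f_sum[OF N'[OF v]] cardN[OF v] by linarith
    also note diff_le_choose_Suc
    finally show "s - sum f (N v) \<le> card (W \<inter> N v \<times> {..<r}) choose Suc t" .
  qed
  finally show ?thesis
    using f_sum[of "pverts G"] Int_absorb2[OF W] by (simp add: mult.commute)
qed

text \<open>Average the previous inequality over \<open>W\<close>: its only random terms are \<open>card W\<close> and the binomial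
  coefficients, and both have expectations given by \<open>expectation_choose_random_subset\<close>.\<close>

lemma domination_number_le_average:
  assumes mt: "(min_degree G + 1) * r = s + t"
    and caps: "\<And>v. v \<in> pverts G \<Longrightarrow> r \<le> rv v"
    and dems: "\<And>v. v \<in> pverts G \<Longrightarrow> sv v \<le> s"
    and q: "0 \<le> q" "q \<le> 1"
  shows "real (domination_number G rv sv)
    \<le> real r * real (card (pverts G)) * (1 - q)
      + real (card (pverts G)) * (real (s + t choose Suc t) * q ^ Suc t)"
proof -
  let ?V = "pverts G" and ?U = "pverts G \<times> {..<r}"
  let ?\<mu> = "random_subset_prob q ?U"
  have finU: "finite ?U" using pair_finite_verts by simp
  have "\<exists>A\<subseteq>closed_nbhd G v. card A = min_degree G + 1" if "v \<in> ?V" for v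
  proof -
    have "min_degree G \<le> out_degree (with_proj G) v"
      unfolding min_degree_def using that pair_finite_verts by simp
    then have "min_degree G + 1 \<le> card (closed_nbhd G v)"
      by (simp add: card_closed_nbhd)
    then show ?thesis by (meson obtain_subset_with_card_n)
  qed
  then obtain N where N: "\<And>v. v \<in> ?V \<Longrightarrow> N v \<subseteq> closed_nbhd G v"
    "\<And>v. v \<in> ?V \<Longrightarrow> card (N v) = min_degree G + 1"
    by metis
  let ?M = "\<lambda>v. N v \<times> {..<r}"
  let ?\<gamma> = "real (domination_number G rv sv)"
  have pointwise: "?\<gamma> + real (card W)
      \<le> real r * real (card ?V) + (\<Sum>v\<in>?V. real (card (W \<inter> ?M v) choose Suc t))"
    if "W \<in> Pow ?U" for W
  proof -
    have "domination_number G rv sv + card W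
        \<le> r * card ?V + (\<Sum>v\<in>?V. card (W \<inter> ?M v) choose Suc t)"
      using that N mt caps dems by (intro domination_number_add_deleted_le[where s = s]) auto
    then have "real (domination_number G rv sv + card W)
        \<le> real (r * card ?V + (\<Sum>v\<in>?V. card (W \<inter> ?M v) choose Suc t))"
      by (rule of_nat_mono)
    then show ?thesis by simp
  qed
  have "?\<gamma> + real (card ?U) * q
      = (\<Sum>W\<in>Pow ?U. ?\<mu> W * ?\<gamma>) + (\<Sum>W\<in>Pow ?U. ?\<mu> W * real (card (W \<inter> ?U) choose 1))"
    using expectation_choose_random_subset[OF finU, of ?U q 1]
    by (simp add: sum_distrib_right[symmetric] sum_random_subset_prob[OF finU])
  also have "\<dots> = (\<Sum>W\<in>Pow ?U. ?\<mu> W * (?\<gamma> + real (card W)))"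
    unfolding sum.distrib[symmetric] by (intro sum.cong) (auto simp: Int_absorb2 distrib_left)
  also have "\<dots> \<le> (\<Sum>W\<in>Pow ?U. ?\<mu> W *
      (real r * real (card ?V) + (\<Sum>v\<in>?V. real (card (W \<inter> ?M v) choose Suc t))))"
    using pointwise q by (intro sum_mono mult_left_mono random_subset_prob_nonneg) auto
  also have "\<dots> = (\<Sum>W\<in>Pow ?U. ?\<mu> W) * (real r * real (card ?V))
      + (\<Sum>W\<in>Pow ?U. \<Sum>v\<in>?V. ?\<mu> W * real (card (W \<inter> ?M v) choose Suc t))"
    by (simp add: distrib_left sum.distrib sum_distrib_left sum_distrib_right)
  also have "\<dots> = real r * real (card ?V)
      + (\<Sum>v\<in>?V. \<Sum>W\<in>Pow ?U. ?\<mu> W * real (card (W \<inter> ?M v) choose Suc t))"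
    by (subst sum.swap) (simp add: sum_random_subset_prob[OF finU])
  also have "(\<Sum>v\<in>?V. \<Sum>W\<in>Pow ?U. ?\<mu> W * real (card (W \<inter> ?M v) choose Suc t))
      = (\<Sum>v\<in>?V. real (s + t choose Suc t) * q ^ Suc t)"
  proof (intro sum.cong refl)
    fix v assume v: "v \<in> ?V"
    have "?M v \<subseteq> ?U" using N(1)[OF v] closed_nbhd_subset[OF v] by blast
    moreover have "card (?M v) = s + t"
      using N(2)[OF v] mt by (simp add: card_cartesian_product)
    ultimately show "(\<Sum>W\<in>Pow ?U. ?\<mu> W * real (card (W \<inter> ?M v) choose Suc t))
        = real (s + t choose Suc t) * q ^ Suc t"
      using expectation_choose_random_subset[OF finU, of "?M v" q "Suc t"] by simp
  qed
  finally show ?thesis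
    by (simp add: card_cartesian_product algebra_simps)
qed

end

section \<open>The optimal deletion probability\<close>

text \<open>The minimiser of \<open>a (1 - q) + b q ^ (t + 1)\<close> is \<open>q = (a / (b (1 + t))) powr (1 / t)\<close>; the
  hypothesis \<open>a \<le> b (1 + t)\<close> makes it a probability.\<close>

lemma optimal_deletion_probability:
  fixes a b \<rho> :: real and t :: nat
  assumes "0 < t" "0 < a" "0 < b" "a \<le> b * (1 + real t)" "\<rho> = 1 / real t"
  obtains q where "0 \<le> q" "q \<le> 1"
    "a * (1 - q) + b * q ^ Suc t
      = (1 - (a * \<rho>) powr \<rho> / ((1 + \<rho>) powr (1 + \<rho>) * b powr \<rho>)) * a"
proof -
  define x where "x = a / (b * (1 + real t))"
  define q where "q = x powr \<rho>"
  have x: "0 < x" "x \<le> 1" using assms by (auto simp: x_def)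
  have \<rho>: "0 < \<rho>" using assms by simp
  have "x powr \<rho> \<le> 1 powr \<rho>" using x \<rho> by (intro powr_mono2) auto
  then have q: "0 < q" "q \<le> 1" using x by (auto simp: q_def)
  have "q ^ t = x"
    using q(1) x assms(1,5) by (simp add: q_def powr_powr flip: powr_realpow)
  then have "a * (1 - q) + b * q ^ Suc t = a * (1 - q) + b * q * x" by simp
  also have "b * q * x = q * a / (1 + real t)"
    using assms(3) by (simp add: x_def)
  also have "a * (1 - q) + q * a / (1 + real t) = (1 - q / (1 + \<rho>)) * a"
  proof -
    have "a * (1 - q) + q * a / (1 + real t) = (1 - q * (1 - 1 / (1 + real t))) * a"
      by (simp add: algebra_simps)
    also have "1 - 1 / (1 + real t) = 1 / (1 + \<rho>)"
      unfolding assms(5) using assms(1) by (simp add: divide_simps)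
    finally show ?thesis by simp
  qed
  also have "q / (1 + \<rho>) = (a * \<rho>) powr \<rho> / ((1 + \<rho>) powr (1 + \<rho>) * b powr \<rho>)"
  proof -
    have "x = (a * \<rho>) / ((1 + \<rho>) * b)"
    proof -
      have "x = (a * \<rho>) / ((b * (1 + real t)) * \<rho>)"
        using \<rho> by (simp add: x_def)
      also have "(b * (1 + real t)) * \<rho> = (1 + \<rho>) * b"
        using assms(1,5) by (simp add: field_simps)
      finally show ?thesis .
    qed
    then have "q = (a * \<rho>) powr \<rho> / ((1 + \<rho>) powr \<rho> * b powr \<rho>)"
      using assms \<rho> by (simp add: q_def powr_divide powr_mult)
    then show ?thesis using \<rho> by (simp add: powr_add mult_ac)
  qed
  finally show thesis by (rule that[OF less_imp_le[OF q(1)] q(2)])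
qed

theorem theorem3:
  fixes G :: "'a pair_pre_digraph"
    and rv sv :: "'a \<Rightarrow> nat"
    and n \<delta> \<tau> s r B :: nat
    and \<theta> \<rho> :: real
  assumes "pair_graph G"
    and "pverts G \<noteq> {}"
    and "n = card (pverts G)"
    and "\<delta> = min_degree G"
    and "\<tau> = Min (rv ` pverts G)"
    and "s = Max (sv ` pverts G)"
    and "r = s div (\<delta> + 1) + 1"
    and "\<theta> = real ((\<delta> + 1) * r) - real s"
    and "B = ((\<delta> + 1) * r) choose (s - 1)"
    and "\<rho> = 1 / \<theta>"
    and "r \<le> \<tau>"
  shows "real (domination_number G rv sv)
    \<le> (1 - (real r * \<rho>) powr \<rho> / ((1 + \<rho>) powr (1 + \<rho>) * real B powr \<rho>)) * real r * real n"
proof -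
  interpret pair_graph G by fact
  define t where "t = (\<delta> + 1) * r - s"
  have "s < (\<delta> + 1) * r"
    unfolding assms(7) by (metis Suc_eq_plus1 dividend_less_times_div zero_less_Suc add.commute
        mult_Suc_right)
  then have t: "0 < t" "(\<delta> + 1) * r = s + t" by (auto simp: t_def)
  have \<theta>: "\<theta> = real t" unfolding assms(8) t(2) by simp
  have r0: "0 < r" using assms(7) by simp
  have B: "B = s + t choose (s - 1)" using assms(9) t(2) by simp
  have B0: "0 < B" unfolding B by (intro zero_less_binomial) simp
  (* For s = 0, truncated subtraction gives B = 1, while the other binomial coefficient is 0. *)
  have chooseB: "s + t choose Suc t \<le> B"
  proof (cases s)
    case (Suc k)
    then show ?thesis unfolding B using binomial_symmetric[of k "s + t"] by simp
  qed (simp add: binomial_eq_0)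
  (* This makes the optimal deletion probability at most 1. For s > 0 it holds since
     B * (t + 1) = (s + t) * (s + t - 1 choose s - 1) and s + t is a positive multiple of r. *)
  have rB: "r \<le> B * (1 + t)"
  proof (cases s)
    case 0
    then show ?thesis using B0 assms(7) by simp
  next
    case (Suc k)
    have "r \<le> (\<delta> + 1) * r" by simp
    also have "\<dots> = s + t" by (rule t(2))
    also have "\<dots> \<le> (s + t) * (s + t - 1 choose k)"
    proof -
      have "1 \<le> s + t - 1 choose k" using Suc by (simp add: Suc_le_eq)
      from mult_le_mono2[OF this] show ?thesis by simp
    qed
    also have "\<dots> = (s + t - k) * (s + t choose k)"
      by (rule binomial_absorb_comp[symmetric])
    also have "\<dots> = B * (1 + t)" using Suc by (simp add: B)
    finally show ?thesis .
  qed
  have rB': "real r \<le> real B * (1 + real t)"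
    using of_nat_mono[OF rB, where 'a = real] by (simp only: of_nat_mult of_nat_add of_nat_1)
  obtain q where q: "0 \<le> q" "q \<le> 1" "real r * (1 - q) + real B * q ^ Suc t
      = (1 - (real r * \<rho>) powr \<rho> / ((1 + \<rho>) powr (1 + \<rho>) * real B powr \<rho>)) * real r"
    using optimal_deletion_probability[of t "real r" "real B" \<rho>] t(1) r0 B0 rB' assms(10) \<theta> by auto
  have "real (domination_number G rv sv)
      \<le> real r * real n * (1 - q) + real n * (real (s + t choose Suc t) * q ^ Suc t)"
    unfolding assms(3)
  proof (rule domination_number_le_average)
    show "(min_degree G + 1) * r = s + t" using t(2) assms(4) by simp
    show "r \<le> rv v" if "v \<in> pverts G" for v
    proof -
      have "\<tau> \<le> rv v" unfolding assms(5) using that pair_finite_verts by simp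
      then show ?thesis using assms(11) by simp
    qed
    show "sv v \<le> s" if "v \<in> pverts G" for v
      unfolding assms(6) using that pair_finite_verts by simp
  qed (use q in auto)
  also have "\<dots> \<le> real r * real n * (1 - q) + real n * (real B * q ^ Suc t)"
    using chooseB q(1) by (intro add_left_mono mult_left_mono mult_right_mono) auto
  also have "\<dots> = (real r * (1 - q) + real B * q ^ Suc t) * real n"
    by (simp add: algebra_simps)
  finally show ?thesis unfolding q(3) .
qed

end
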